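(* Let $R$ be a commutative ring, $I$ an ideal of $R$, $n\ge2$, and let $\varphi$ be a $2n\times2n$ alternating matrix over $R$ with Pfaffian $1$. Then ${\rm E}_{2n-1}(R,I)={\rm E}_\varphi(R,I)$.
   Context: ${\rm E}_m(R)$ is the subgroup of ${\rm SL}_m(R)$ generated by $E_{ij}(\lambda)=I_m+\lambda e_{ij}$ ($i\neq j$, $\lambda\in R$); ${\rm E}_m(I)$ is the subgroup generated by $E_{ij}(x)$ with $x\in I$, and ${\rm E}_m(R,I)$ is the normal closure of ${\rm E}_m(I)$ in ${\rm E}_m(R)$. A square matrix is alternating if it is of the form $\nu-\nu^t$; alternating matrices of Pfaffian $1$ are invertible. Elements of $R^m$ are row vectors, ${}^t$ is transpose. For an invertible alternating $2n\times2n$ matrix $\varphi$ write $\varphi=\begin{pmatrix}0&-c\\ c^t&\nu\end{pmatrix}$, $\varphi^{-1}=\begin{pmatrix}0&d\\ -d^t&\mu\end{pmatrix}$ with $c,d\in R^{2n-1}$, and set $\alpha_\varphi(v)=I_{2n-1}+d^tv\nu$, $\beta_\varphi(v)=I_{2n-1}+\mu v^tc$. ${\rm E}_\varphi(R)$ is the subgroup of ${\rm GL}_{2n-1}(R)$ generated by all $\alpha_\varphi(v),\beta_\varphi(v)$, $v\in R^{2n-1}$; ${\rm E}_\varphi(I)$ is the subgroup generated by $\alpha_\varphi(v),\beta_\varphi(v)$ with $v\in I^{2n-1}$; and ${\rm E}_\varphi(R,I)$ is the normal closure of ${\rm E}_\varphi(I)$ in ${\rm E}_\varphi(R)$. *)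

theory Defs
  imports "Jordan_Normal_Form.Matrix" "HOL-Combinatorics.Permutations"
begin

definition is_ideal :: "'a::comm_ring_1 set \<Rightarrow> bool" where
  "is_ideal I \<longleftrightarrow> 0 \<in> I \<and> (\<forall>x\<in>I. \<forall>y\<in>I. x + y \<in> I) \<and> (\<forall>x\<in>I. - x \<in> I)
     \<and> (\<forall>r x. x \<in> I \<longrightarrow> r * x \<in> I)"

definition alternating_mat :: "nat \<Rightarrow> 'a::comm_ring_1 mat \<Rightarrow> bool" where
  "alternating_mat m A \<longleftrightarrow> A \<in> carrier_mat m m \<and>
     (\<exists>\<nu> \<in> carrier_mat m m. A = \<nu> - transpose_mat \<nu>)"

definition pfaffian :: "nat \<Rightarrow> 'a::comm_ring_1 mat \<Rightarrow> 'a" where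
  "pfaffian n A = (\<Sum>\<sigma> \<in> {\<sigma>. \<sigma> permutes {0..<2*n}
        \<and> (\<forall>i<n. \<sigma> (2*i) < \<sigma> (2*i+1))
        \<and> (\<forall>i. Suc i < n \<longrightarrow> \<sigma> (2*i) < \<sigma> (2*(Suc i)))}.
      of_int (sign \<sigma>) * (\<Prod>i<n. A $$ (\<sigma> (2*i), \<sigma> (2*i+1))))"

definition elem_mat :: "nat \<Rightarrow> nat \<Rightarrow> nat \<Rightarrow> 'a::comm_ring_1 \<Rightarrow> 'a mat" where
  "elem_mat m i j l = 1\<^sub>m m + mat m m (\<lambda>(a,b). if a = i \<and> b = j then l else 0)"

inductive_set gen_group :: "nat \<Rightarrow> 'a::comm_ring_1 mat set \<Rightarrow> 'a mat set"
  for m :: nat and S :: "'a mat set" where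
  gen_one: "1\<^sub>m m \<in> gen_group m S"
| gen_base: "g \<in> S \<Longrightarrow> g \<in> gen_group m S"
| gen_mult: "a \<in> gen_group m S \<Longrightarrow> b \<in> gen_group m S \<Longrightarrow> a * b \<in> gen_group m S"
| gen_inv: "a \<in> gen_group m S \<Longrightarrow> b \<in> carrier_mat m m \<Longrightarrow> a * b = 1\<^sub>m m \<Longrightarrow> b * a = 1\<^sub>m m
     \<Longrightarrow> b \<in> gen_group m S"

definition normal_closure :: "nat \<Rightarrow> 'a::comm_ring_1 mat set \<Rightarrow> 'a mat set \<Rightarrow> 'a mat set" where
  "normal_closure m G S = gen_group m {g * h * g' | g h g'. g \<in> G \<and> h \<in> gen_group m S
      \<and> g' \<in> carrier_mat m m \<and> g * g' = 1\<^sub>m m \<and> g' * g = 1\<^sub>m m}"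

definition E_gens :: "nat \<Rightarrow> 'a::comm_ring_1 set \<Rightarrow> 'a mat set" where
  "E_gens m I = {elem_mat m i j l | i j l. i < m \<and> j < m \<and> i \<noteq> j \<and> l \<in> I}"

definition E_rel :: "nat \<Rightarrow> 'a::comm_ring_1 set \<Rightarrow> 'a mat set" where
  "E_rel m I = normal_closure m (gen_group m (E_gens m UNIV)) (E_gens m I)"

text \<open>Data attached to phi (2n x 2n, with inverse psi), m = 2n-1:
  phi = [[0, -c],[c^t, nu]], psi = [[0, d],[-d^t, mu]].\<close>
definition phi_c :: "nat \<Rightarrow> 'a::comm_ring_1 mat \<Rightarrow> 'a mat" where
  "phi_c m \<phi> = mat 1 m (\<lambda>(i,j). - (\<phi> $$ (0, Suc j)))"
definition phi_nu :: "nat \<Rightarrow> 'a::comm_ring_1 mat \<Rightarrow> 'a mat" where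
  "phi_nu m \<phi> = mat m m (\<lambda>(i,j). \<phi> $$ (Suc i, Suc j))"
definition psi_d :: "nat \<Rightarrow> 'a::comm_ring_1 mat \<Rightarrow> 'a mat" where
  "psi_d m \<psi> = mat 1 m (\<lambda>(i,j). \<psi> $$ (0, Suc j))"
definition psi_mu :: "nat \<Rightarrow> 'a::comm_ring_1 mat \<Rightarrow> 'a mat" where
  "psi_mu m \<psi> = mat m m (\<lambda>(i,j). \<psi> $$ (Suc i, Suc j))"

definition alpha_phi :: "nat \<Rightarrow> 'a::comm_ring_1 mat \<Rightarrow> 'a mat \<Rightarrow> 'a mat \<Rightarrow> 'a mat" where
  "alpha_phi m \<phi> \<psi> v = 1\<^sub>m m + transpose_mat (psi_d m \<psi>) * v * phi_nu m \<phi>"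
definition beta_phi :: "nat \<Rightarrow> 'a::comm_ring_1 mat \<Rightarrow> 'a mat \<Rightarrow> 'a mat \<Rightarrow> 'a mat" where
  "beta_phi m \<phi> \<psi> v = 1\<^sub>m m + psi_mu m \<psi> * transpose_mat v * phi_c m \<phi>"

definition Ephi_gens :: "nat \<Rightarrow> 'a::comm_ring_1 mat \<Rightarrow> 'a mat \<Rightarrow> 'a set \<Rightarrow> 'a mat set" where
  "Ephi_gens m \<phi> \<psi> I = {alpha_phi m \<phi> \<psi> v | v. v \<in> carrier_mat 1 m \<and> (\<forall>j<m. v $$ (0,j) \<in> I)}
     \<union> {beta_phi m \<phi> \<psi> v | v. v \<in> carrier_mat 1 m \<and> (\<forall>j<m. v $$ (0,j) \<in> I)}"

definition Ephi_rel :: "nat \<Rightarrow> 'a::comm_ring_1 mat \<Rightarrow> 'a mat \<Rightarrow> 'a set \<Rightarrow> 'a mat set" where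
  "Ephi_rel m \<phi> \<psi> I = normal_closure m (gen_group m (Ephi_gens m \<phi> \<psi> UNIV)) (Ephi_gens m \<phi> \<psi> I)"

end

theory Submission
  imports Defs
begin

text \<open>
  Write \<open>T x y = 1 + x y\<close> for a column \<open>x\<close> and a row \<open>y\<close> with \<open>y x = 0\<close>. The block relations between
  \<open>\<phi>\<close> and its inverse say that the generators of \<open>E\<^sub>\<phi>\<close> are exactly the \<open>T d w\<close> with \<open>w d = 0\<close> and
  the \<open>T u c\<close> with \<open>c u = 0\<close>, where \<open>c d = 1\<close>; the elementary group arises in the same way from
  \<open>c = d = e\<^sub>0\<close>. For any such pair with group \<open>G\<close> and relative normal closure \<open>N\<close>, every
  \<open>T x y\<close> with \<open>x\<close> unimodular and \<open>y\<close> over \<open>I\<close> (or, by transposition, vice versa) lies in \<open>N\<close>, so either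
  group contains the generators of the other. Namely, the scalars \<open>l\<close> with \<open>T x (l y) \<in> N\<close> for all \<open>y\<close> form an ideal \<open>A x\<close>.
  If \<open>g d = g x = 0\<close> and \<open>c u = 0\<close>, the commutator of \<open>T x g\<close> with \<open>T u ((g u) y - (y u) g)\<close> shows
  \<open>(g u)\<^sup>2 \<in> A x\<close>; hence, as \<open>m \<ge> 3\<close>, the squares of the 2-by-2 minors of \<open>(d | x)\<close> lie in \<open>A x\<close>.
  Since \<open>A\<close> does not change when \<open>T u c\<close> is applied to \<open>x\<close>, the radical of \<open>A x\<close> then contains \<open>(c x) d\<close>,
  thus \<open>c x\<close>, thus all entries of \<open>x\<close>, and is the unit ideal.
\<close>

section \<open>Dot products and transvection matrices\<close>

definition dotp :: "nat \<Rightarrow> (nat \<Rightarrow> 'a::comm_ring_1) \<Rightarrow> (nat \<Rightarrow> 'a) \<Rightarrow> 'a" where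
  "dotp m y x = (\<Sum>i<m. y i * x i)"

definition transv :: "nat \<Rightarrow> (nat \<Rightarrow> 'a::comm_ring_1) \<Rightarrow> (nat \<Rightarrow> 'a) \<Rightarrow> 'a mat" where
  "transv m x y = mat m m (\<lambda>(i, j). (if i = j then 1 else 0) + x i * y j)"

lemma dotp_comm: "dotp m y x = dotp m x y"
  by (simp add: dotp_def mult.commute)

lemma dotp_linear [simp]:
  "dotp m (\<lambda>i. f i + g i) x = dotp m f x + dotp m g x"
  "dotp m (\<lambda>i. f i - g i) x = dotp m f x - dotp m g x"
  "dotp m (\<lambda>i. - f i) x = - dotp m f x"
  "dotp m (\<lambda>i. a * f i) x = a * dotp m f x"
  "dotp m x (\<lambda>i. f i + g i) = dotp m x f + dotp m x g"
  "dotp m x (\<lambda>i. f i - g i) = dotp m x f - dotp m x g"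
  "dotp m x (\<lambda>i. - f i) = - dotp m x f"
  "dotp m x (\<lambda>i. a * f i) = a * dotp m x f"
  "dotp m (\<lambda>i. 0) x = 0"
  "dotp m x (\<lambda>i. 0) = 0"
  by (simp_all add: dotp_def algebra_simps sum.distrib sum_subtractf sum_negf sum_distrib_left)

lemma dotp_delta [simp]:
  "k < m \<Longrightarrow> dotp m (\<lambda>i. if i = k then a else 0) x = a * x k"
  "k < m \<Longrightarrow> dotp m x (\<lambda>i. if i = k then a else 0) = x k * a"
  by (simp_all add: dotp_def if_distrib[of "\<lambda>t. t * _"] if_distrib[of "\<lambda>t. _ * t"] cong: if_cong)

text \<open>Associativity of row times matrix times column, \<open>h k j\<close> being the matrix
  entry; it amounts to exchanging two finite sums.\<close>

lemma dotp_dotp: "dotp m (\<lambda>j. dotp m f (\<lambda>k. h k j)) x = dotp m f (\<lambda>k. dotp m (h k) x)"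
proof -
  have "dotp m (\<lambda>j. dotp m f (\<lambda>k. h k j)) x = (\<Sum>j<m. \<Sum>k<m. f k * h k j * x j)"
    by (simp add: dotp_def sum_distrib_right)
  also have "\<dots> = (\<Sum>k<m. \<Sum>j<m. f k * h k j * x j)"
    by (rule sum.swap)
  also have "\<dots> = dotp m f (\<lambda>k. dotp m (h k) x)"
    by (simp add: dotp_def sum_distrib_left mult.assoc)
  finally show ?thesis .
qed

lemma transv_carrier [simp]: "transv m x y \<in> carrier_mat m m"
  by (simp add: transv_def)

lemma transv_cong:
  assumes "\<And>i j. i < m \<Longrightarrow> j < m \<Longrightarrow> x i * y j = x' i * y' j"
  shows "transv m x y = transv m x' y'"
  using assms by (auto simp: transv_def)

lemma transv_zero [simp]:
  "transv m x (\<lambda>i. 0) = 1\<^sub>m m" "transv m (\<lambda>i. 0) y = 1\<^sub>m m"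
  by (auto simp: transv_def)

lemma transv_transpose [simp]: "transpose_mat (transv m x y) = transv m y x"
  by (auto simp: transv_def)

lemma mult_transv_index:
  assumes "M \<in> carrier_mat m m" "i < m" "j < m"
  shows "(M * transv m z w) $$ (i, j) = M $$ (i, j) + dotp m (\<lambda>k. M $$ (i, k)) z * w j"
proof -
  have "(M * transv m z w) $$ (i, j)
      = (\<Sum>k<m. M $$ (i, k) * ((if k = j then 1 else 0) + z k * w j))"
    using assms by (simp add: scalar_prod_def transv_def lessThan_atLeast0)
  also have "\<dots> = (\<Sum>k<m. (if k = j then M $$ (i, k) else 0) + M $$ (i, k) * z k * w j)"
    by (rule sum.cong) (auto simp: algebra_simps)
  also have "\<dots> = M $$ (i, j) + dotp m (\<lambda>k. M $$ (i, k)) z * w j"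
    using assms by (simp add: sum.distrib dotp_def sum_distrib_right)
  finally show ?thesis .
qed

lemma dotp_transv_row:
  assumes "i < m"
  shows "dotp m (\<lambda>k. transv m x y $$ (i, k)) z = z i + x i * dotp m y z"
proof -
  have "dotp m (\<lambda>k. transv m x y $$ (i, k)) z
      = dotp m (\<lambda>k. (if k = i then 1 else 0) + x i * y k) z"
    unfolding dotp_def by (rule sum.cong) (use assms in \<open>auto simp: transv_def\<close>)
  also have "\<dots> = z i + x i * dotp m y z"
    using assms by simp
  finally show ?thesis .
qed

lemma transv_mult:
  "transv m x y * transv m z w
     = mat m m (\<lambda>(i, j). transv m x y $$ (i, j) + (z i + x i * dotp m y z) * w j)"
proof (rule eq_matI, goal_cases)
  case (1 i j)
  then show ?case
    using mult_transv_index[OF transv_carrier, of i m j x y z w]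
    by (simp add: dotp_transv_row)
qed (simp_all add: transv_def)

lemma transv_mult_same_right:
  assumes "dotp m y z = 0"
  shows "transv m x y * transv m z y = transv m (\<lambda>i. x i + z i) y"
  unfolding transv_mult using assms by (auto simp: transv_def algebra_simps)

lemma transv_mult_same_left:
  assumes "dotp m y x = 0"
  shows "transv m x y * transv m x w = transv m x (\<lambda>i. y i + w i)"
  unfolding transv_mult using assms by (auto simp: transv_def algebra_simps)

lemma transv_inverse:
  assumes "dotp m y x = 0"
  shows "transv m x y * transv m (\<lambda>i. - x i) y = 1\<^sub>m m"
    and "transv m (\<lambda>i. - x i) y * transv m x y = 1\<^sub>m m"
  using assms by (simp_all add: transv_mult_same_right)

text \<open>Write \<open>P = transv m x g\<close>. Conjugation carries \<open>1 + u y\<close> to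
  \<open>1 + (P u) (y P')\<close>, where \<open>P' = 1 - x g\<close> is the inverse of
  \<open>P\<close> because \<open>g x = 0\<close>. Then \<open>P u = u + (g u) x\<close> and
  \<open>y P' = y - (y x) g\<close>.\<close>

lemma transv_conj:
  assumes "dotp m g x = 0"
  shows "transv m x g * transv m u y * transv m (\<lambda>i. - x i) g
    = transv m (\<lambda>i. u i + dotp m g u * x i) (\<lambda>i. y i - dotp m y x * g i)"
proof -
  define M where "M = transv m x g * transv m u y"
  have M: "M \<in> carrier_mat m m" unfolding M_def by (simp add: transv_mult)
  have Mij: "M $$ (i, j) = transv m x g $$ (i, j) + (u i + x i * dotp m g u) * y j"
    if "i < m" "j < m" for i j
    using that by (simp add: M_def transv_mult)
  have row: "dotp m (\<lambda>k. M $$ (i, k)) (\<lambda>i. - x i)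
      = - x i - (u i + x i * dotp m g u) * dotp m y x" if "i < m" for i
  proof -
    have "dotp m (\<lambda>k. M $$ (i, k)) (\<lambda>i. - x i)
       = dotp m (\<lambda>k. transv m x g $$ (i, k) + (u i + x i * dotp m g u) * y k) (\<lambda>i. - x i)"
      unfolding dotp_def by (rule sum.cong) (use that Mij in \<open>auto simp: dotp_def\<close>)
    also have "\<dots> = - x i - (u i + x i * dotp m g u) * dotp m y x"
      using that assms dotp_transv_row[of i m x g x] by simp
    finally show ?thesis .
  qed
  show ?thesis
    unfolding M_def[symmetric]
  proof (rule eq_matI, goal_cases)
    case (1 i j)
    then have ij: "i < m" "j < m" by (simp_all add: transv_def)
    show ?case
      using ij by (simp only: mult_transv_index[OF M ij] row[OF ij(1)] Mij[OF ij])
        (simp add: transv_def algebra_simps)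
  qed (use M in \<open>simp_all add: transv_def\<close>)
qed

section \<open>Ideals and radicals\<close>

lemma is_idealD:
  assumes "is_ideal I"
  shows "0 \<in> I" "x \<in> I \<Longrightarrow> y \<in> I \<Longrightarrow> x + y \<in> I" "x \<in> I \<Longrightarrow> - x \<in> I"
    "x \<in> I \<Longrightarrow> r * x \<in> I" "x \<in> I \<Longrightarrow> x * r \<in> I" "x \<in> I \<Longrightarrow> y \<in> I \<Longrightarrow> x - y \<in> I"
proof -
  show "0 \<in> I" "x \<in> I \<Longrightarrow> y \<in> I \<Longrightarrow> x + y \<in> I" "x \<in> I \<Longrightarrow> - x \<in> I"
    "x \<in> I \<Longrightarrow> r * x \<in> I" "x \<in> I \<Longrightarrow> x * r \<in> I" for x y r
    using assms by (auto simp: is_ideal_def mult.commute[of _ r])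
  from this(2)[of x "- y"] this(3)[of y] show "x \<in> I \<Longrightarrow> y \<in> I \<Longrightarrow> x - y \<in> I" by simp
qed

lemma is_ideal_UNIV: "is_ideal UNIV"
  by (simp add: is_ideal_def)

lemma is_ideal_sum:
  assumes "is_ideal I" "\<And>i. i \<in> S \<Longrightarrow> f i \<in> I"
  shows "sum f S \<in> I"
  using assms(2) by (induction S rule: infinite_finite_induct) (auto intro: is_idealD[OF assms(1)])

lemma is_ideal_radical:
  fixes A :: "'a::comm_ring_1 set"
  assumes A: "is_ideal A"
  shows "is_ideal {r. \<exists>n. r ^ n \<in> A}"
proof -
  note [intro] = is_idealD[OF A]
  have add: "\<exists>k. (r + s) ^ k \<in> A" if rs: "r ^ n \<in> A" "s ^ l \<in> A" for r s :: 'a and n l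
  proof -
    have "(r + s) ^ (n + l) \<in> A"
      unfolding binomial_ring
    proof (rule is_ideal_sum[OF A])
      fix k assume "k \<in> {..n + l}"
      \<comment> \<open>In every term of the binomial expansion either the exponent of
        \<open>r\<close> reaches \<open>n\<close> or that of \<open>s\<close> reaches
        \<open>l\<close>.\<close>
      then consider "n \<le> k" | "l \<le> n + l - k" by fastforce
      then show "of_nat (n + l choose k) * r ^ k * s ^ (n + l - k) \<in> A"
      proof cases
        case 1
        then have "r ^ k = r ^ n * r ^ (k - n)" by (simp flip: power_add)
        then show ?thesis using rs(1) by auto
      next
        case 2
        then have "s ^ (n + l - k) = s ^ l * s ^ (n + l - k - l)" by (metis le_add_diff_inverse power_add)
        then show ?thesis using rs(2) by auto
      qed
    qed
    then show ?thesis ..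
  qed
  have mult: "\<exists>k. (t * r) ^ k \<in> A" if "r ^ n \<in> A" for r t n
    using that by (auto simp: power_mult_distrib)
  have "\<exists>n. (0::'a) ^ n \<in> A"
    \<comment> \<open>An exponent of 0 would not do, since \<open>0 ^ 0 = 1\<close>.\<close>
    by (rule exI[of _ 1]) auto
  then show ?thesis
    using add mult mult[of _ _ "-1"] by (auto simp: is_ideal_def)
qed

section \<open>Transvections relative to a row \<open>c\<close> and a column \<open>d\<close> with
  \<open>c d = 1\<close>\<close>

text \<open>Stating only closure properties lets the same argument serve the elementary group, the
  group of the alternating matrix, their absolute versions (\<open>N = G\<close>) and their
  transposes. Inverses are expressed by negating the column: \<open>1 - x g\<close> inverts
  \<open>1 + x g\<close> when \<open>g x = 0\<close>.\<close>

locale transvection_pair =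
  fixes m :: nat and I :: "'a::comm_ring_1 set" and c d :: "nat \<Rightarrow> 'a" and G N :: "'a mat set"
  assumes ideal: "is_ideal I"
    and m3: "m \<ge> 3"
    and cd: "dotp m c d = 1"
    and G_carrier: "G \<subseteq> carrier_mat m m"
    and G_mult: "A \<in> G \<Longrightarrow> B \<in> G \<Longrightarrow> A * B \<in> G"
    and G_inv: "transv m x g \<in> G \<Longrightarrow> dotp m g x = 0 \<Longrightarrow> transv m (\<lambda>i. - x i) g \<in> G"
    and G_d: "dotp m w d = 0 \<Longrightarrow> transv m d w \<in> G"
    and G_c: "dotp m c u = 0 \<Longrightarrow> transv m u c \<in> G"
    and N_carrier: "N \<subseteq> carrier_mat m m"
    and N_mult: "A \<in> N \<Longrightarrow> B \<in> N \<Longrightarrow> A * B \<in> N"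
    and N_conj: "transv m x g \<in> G \<Longrightarrow> dotp m g x = 0 \<Longrightarrow> A \<in> N \<Longrightarrow>
      transv m x g * A * transv m (\<lambda>i. - x i) g \<in> N"
    and N_d: "dotp m w d = 0 \<Longrightarrow> (\<And>i. i < m \<Longrightarrow> w i \<in> I) \<Longrightarrow> transv m d w \<in> N"
    and N_c: "dotp m c u = 0 \<Longrightarrow> (\<And>i. i < m \<Longrightarrow> u i \<in> I) \<Longrightarrow> transv m u c \<in> N"
begin

text \<open>Conjugating \<open>1 + d w\<close> by \<open>1 + u c\<close> turns the column
  \<open>d\<close> into \<open>d + u\<close>, since \<open>c d = 1\<close>, and keeps the row
  \<open>w\<close>, since \<open>w u = 0\<close>. Multiplying by \<open>1 - d w\<close> leaves
  \<open>1 + u w\<close>.\<close>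

lemma transv_N_ker_c_ker_d:
  assumes "dotp m c u = 0" "dotp m w d = 0" "dotp m w u = 0" "\<And>i. i < m \<Longrightarrow> w i \<in> I"
  shows "transv m u w \<in> N"
proof -
  have "transv m u c * transv m d w * transv m (\<lambda>i. - u i) c \<in> N"
    by (intro N_conj G_c N_d assms)
  then have 1: "transv m (\<lambda>i. d i + u i) w \<in> N"
    using assms cd by (simp add: transv_conj)
  have "transv m d (\<lambda>i. - w i) \<in> N"
    by (intro N_d) (use assms in \<open>auto intro: is_idealD[OF ideal]\<close>)
  then have "transv m (\<lambda>i. - d i) w \<in> N"
    by (simp add: transv_cong[of m "\<lambda>i. - d i" w d "\<lambda>i. - w i"])
  from N_mult[OF 1 this] show ?thesis
    using assms by (simp add: transv_mult_same_right)
qed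

text \<open>Split \<open>y = (y - b c) + b c\<close> with \<open>b = y d\<close>. The first summand
  annihilates \<open>d\<close> as well as \<open>u\<close>; in the second the scalar
  \<open>b\<close> moves to the column, where \<open>N_c\<close> applies.\<close>

lemma transv_N_ker_c:
  assumes "dotp m c u = 0" "dotp m y u = 0" "\<And>i. i < m \<Longrightarrow> y i \<in> I"
  shows "transv m u y \<in> N"
proof -
  define b where "b = dotp m y d"
  have b: "b \<in> I"
    unfolding b_def dotp_def by (intro is_ideal_sum[OF ideal] is_idealD(5)[OF ideal]) (simp add: assms)
  have "transv m u (\<lambda>i. y i - b * c i) \<in> N"
    by (intro transv_N_ker_c_ker_d is_idealD(6)[OF ideal] is_idealD(5)[OF ideal])
       (use assms b cd in \<open>auto simp: b_def\<close>)
  moreover have "transv m (\<lambda>i. b * u i) c \<in> N"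
    by (intro N_c is_idealD(5)[OF ideal]) (use assms b in auto)
  then have "transv m u (\<lambda>i. b * c i) \<in> N"
    by (simp add: transv_cong[of m u "\<lambda>i. b * c i" "\<lambda>i. b * u i" c])
  ultimately have "transv m u (\<lambda>i. y i - b * c i) * transv m u (\<lambda>i. b * c i) \<in> N"
    by (rule N_mult)
  then show ?thesis
    using assms by (simp add: transv_mult_same_left)
qed

text \<open>Split the column as \<open>x = a d + (x - a d)\<close> with \<open>a = c x\<close>. The
  first part falls under \<open>N_d\<close> after moving \<open>a\<close> to the row; the second
  lies in the kernel of \<open>c\<close>.\<close>

lemma transv_N_ker_d:
  assumes "dotp m g d = 0" "dotp m g x = 0" "\<And>i. i < m \<Longrightarrow> g i \<in> I"
  shows "transv m x g \<in> N"
proof -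
  define a where "a = dotp m c x"
  have "transv m d (\<lambda>i. a * g i) \<in> N"
    by (intro N_d is_idealD(4)[OF ideal]) (use assms in auto)
  then have 1: "transv m (\<lambda>i. a * d i) g \<in> N"
    by (simp add: transv_cong[of m d "\<lambda>i. a * g i" "\<lambda>i. a * d i" g])
  have "transv m (\<lambda>i. x i - a * d i) g \<in> N"
    by (intro transv_N_ker_c) (use assms cd in \<open>auto simp: a_def\<close>)
  from N_mult[OF 1 this] show ?thesis
    using assms by (simp add: transv_mult_same_right)
qed

text \<open>Through this instance each membership result for \<open>N\<close> also yields one for
  \<open>G\<close>, with entries in the whole ring.\<close>

lemma absolute: "transvection_pair m UNIV c d G G"
  by unfold_locales
     (use m3 cd G_carrier G_mult G_inv G_d G_c in \<open>simp_all add: is_ideal_UNIV\<close>)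

text \<open>Transposition interchanges rows and columns, hence \<open>c\<close> and
  \<open>d\<close>. It turns results about unimodular columns into results about unimodular
  rows.\<close>

lemma dual: "transvection_pair m I d c (transpose_mat ` G) (transpose_mat ` N)"
proof -
  have transv_iff: "transv m x y \<in> transpose_mat ` X \<longleftrightarrow> transv m y x \<in> X" for x y X
    by (metis (no_types, lifting) image_iff transpose_transpose transv_transpose)
  have neg: "transv m x (\<lambda>i. - y i) = transv m (\<lambda>i. - x i) y" for x y
    by (rule transv_cong) simp
  show ?thesis
  proof (unfold_locales, goal_cases)
    \<comment> \<open>Goals 5, 10 and 11 are \<open>G_mult\<close>, \<open>N_mult\<close> and
      \<open>N_conj\<close>, where transposition reverses the order of the factors.\<close>
    case (5 A B)
    then obtain A' B' where "A' \<in> G" "B' \<in> G" "A = transpose_mat A'" "B = transpose_mat B'" by auto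
    then show ?case
      using transpose_mult[of B' m m A' m] subsetD[OF G_carrier] G_mult[of B' A']
      by (intro image_eqI[of _ _ "B' * A'"]) simp_all
  next
    case (10 A B)
    then obtain A' B' where "A' \<in> N" "B' \<in> N" "A = transpose_mat A'" "B = transpose_mat B'" by auto
    then show ?case
      using transpose_mult[of B' m m A' m] subsetD[OF N_carrier] N_mult[of B' A']
      by (intro image_eqI[of _ _ "B' * A'"]) simp_all
  next
    case (11 x g A)
    then obtain A' where A': "A' \<in> N" "A = transpose_mat A'" by auto
    have xg: "dotp m x g = 0" using 11 by (simp add: dotp_comm)
    have c: "A' \<in> carrier_mat m m" using A' N_carrier by auto
    \<comment> \<open>Because of that reversal, the conjugating matrix here is the inverse of the
      transpose of \<open>transv m x g\<close>.\<close>
    have "transv m (\<lambda>i. - g i) x * A' * transv m (\<lambda>i. - (- g i)) x \<in> N"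
      by (rule N_conj) (use 11 xg A' G_inv in \<open>auto simp: transv_iff\<close>)
    then have "transpose_mat (transv m (\<lambda>i. - g i) x * A' * transv m g x) \<in> transpose_mat ` N"
      by simp
    also have "transpose_mat (transv m (\<lambda>i. - g i) x * A' * transv m g x)
        = transv m x g * (transpose_mat A' * transv m (\<lambda>i. - x i) g)"
      using c transpose_mult[of "transv m (\<lambda>i. - g i) x * A'" m m "transv m g x" m]
        transpose_mult[of "transv m (\<lambda>i. - g i) x" m m "A'" m]
      by (simp add: neg mult_carrier_mat[OF transv_carrier c])
    also have "\<dots> = transv m x g * A * transv m (\<lambda>i. - x i) g"
      using c by (simp add: A' assoc_mult_mat[of _ m m _ m _ m])
    finally show ?case .
  qed (use ideal m3 cd G_carrier N_carrier G_inv G_d G_c N_d N_c in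
        \<open>auto simp: transv_iff dotp_comm neg simp flip: neg\<close>)
qed

text \<open>This is the ideal \<open>A x\<close> of the overview. The aim is to show that it
  contains 1 when \<open>x\<close> is unimodular.\<close>

definition coeff_ideal :: "(nat \<Rightarrow> 'a) \<Rightarrow> 'a set" where
  "coeff_ideal x = {l. \<forall>y. dotp m y x = 0 \<longrightarrow> (\<forall>i<m. y i \<in> I) \<longrightarrow> transv m x (\<lambda>i. l * y i) \<in> N}"

lemma coeff_idealI:
  assumes "\<And>y. dotp m y x = 0 \<Longrightarrow> (\<And>i. i < m \<Longrightarrow> y i \<in> I) \<Longrightarrow> transv m x (\<lambda>i. l * y i) \<in> N"
  shows "l \<in> coeff_ideal x"
  using assms by (simp add: coeff_ideal_def)

lemma coeff_idealD:
  assumes "l \<in> coeff_ideal x" "dotp m y x = 0" "\<And>i. i < m \<Longrightarrow> y i \<in> I"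
  shows "transv m x (\<lambda>i. l * y i) \<in> N"
  using assms by (simp add: coeff_ideal_def)

text \<open>Sums come from multiplying transvections with the common column \<open>x\<close>.
  Negation and scaling are absorbed into \<open>y\<close>, which keeps its entries in
  \<open>I\<close> and still annihilates \<open>x\<close>.\<close>

lemma is_ideal_coeff_ideal: "is_ideal (coeff_ideal x)"
  unfolding is_ideal_def
proof (intro conjI ballI allI impI)
  show "0 \<in> coeff_ideal x"
    using N_d[of "\<lambda>i. 0"] is_idealD(1)[OF ideal] by (auto intro!: coeff_idealI)
next
  fix l k assume "l \<in> coeff_ideal x" "k \<in> coeff_ideal x"
  then show "l + k \<in> coeff_ideal x"
    by (intro coeff_idealI)
       (use N_mult[OF coeff_idealD coeff_idealD] in
         \<open>fastforce simp: transv_mult_same_left distrib_right\<close>)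
next
  fix l assume l: "l \<in> coeff_ideal x"
  show "- l \<in> coeff_ideal x"
    by (intro coeff_idealI)
       (use coeff_idealD[OF l, of "\<lambda>i. - _ i"] in \<open>auto intro: is_idealD[OF ideal]\<close>)
next
  fix r l assume l: "l \<in> coeff_ideal x"
  show "r * l \<in> coeff_ideal x"
  proof (rule coeff_idealI)
    fix y assume "dotp m y x = 0" "\<And>i. i < m \<Longrightarrow> y i \<in> I"
    then have "transv m x (\<lambda>i. l * (r * y i)) \<in> N"
      by (intro coeff_idealD[OF l]) (auto intro: is_idealD[OF ideal])
    then show "transv m x (\<lambda>i. r * l * y i) \<in> N" by (simp add: ac_simps)
  qed
qed

lemma square_in_coeff_ideal:
  assumes g: "dotp m g d = 0" "dotp m g x = 0" and u: "dotp m c u = 0"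
  shows "(dotp m g u)\<^sup>2 \<in> coeff_ideal x"
proof (rule coeff_idealI)
  fix y assume y: "dotp m y x = 0" "\<And>i. i < m \<Longrightarrow> y i \<in> I"
  define s where "s = dotp m g u"
  define t where "t = dotp m y u"
  \<comment> \<open>\<open>z\<close> is the combination of \<open>y\<close> and \<open>g\<close>
    that annihilates \<open>u\<close>, so \<open>1 + u z\<close> lies in \<open>N\<close>.
    Conjugation by \<open>1 + x g\<close> then adds \<open>s x\<close> to the column, and cancelling
    \<open>u\<close> leaves \<open>1 + x (s z)\<close>. One factor \<open>s\<close> comes from
    \<open>z\<close> and one from the conjugation, hence the square.\<close>
  define z where "z = (\<lambda>i. s * y i - t * g i)"
  have t: "t \<in> I"
    unfolding t_def dotp_def by (intro is_ideal_sum[OF ideal] is_idealD(5)[OF ideal]) (simp add: y)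
  have z: "dotp m z x = 0" "dotp m z u = 0"
    using g y by (simp_all add: z_def s_def t_def)
  have zI: "z i \<in> I" if "i < m" for i
    unfolding z_def by (intro is_idealD(6)[OF ideal] is_idealD(4)[OF ideal] y that
        is_idealD(5)[OF ideal] t)
  \<comment> \<open>The entries of \<open>g\<close> are arbitrary, so the absolute version is needed
    here.\<close>
  have xg: "transv m x g \<in> G"
    by (rule transvection_pair.transv_N_ker_d[OF absolute]) (use g in auto)
  have "transv m x g * transv m u z * transv m (\<lambda>i. - x i) g \<in> N"
    by (intro N_conj xg g transv_N_ker_c u z zI)
  then have 1: "transv m (\<lambda>i. u i + s * x i) z \<in> N"
    using g z by (simp add: transv_conj s_def)
  have 2: "transv m (\<lambda>i. - u i) z \<in> N"
    by (intro transv_N_ker_c zI) (use u z in auto)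
  have "transv m (\<lambda>i. s * x i) z \<in> N"
    using N_mult[OF 1 2] z by (simp add: transv_mult_same_right)
  then have 3: "transv m x (\<lambda>i. s * z i) \<in> N"
    by (simp add: transv_cong[of m x "\<lambda>i. s * z i" "\<lambda>i. s * x i" z])
  \<comment> \<open>This restores the term \<open>s t g\<close> by which \<open>s z\<close> differs
    from the square of \<open>s\<close> times \<open>y\<close>.\<close>
  have 4: "transv m x (\<lambda>i. (s * t) * g i) \<in> N"
    by (intro transv_N_ker_d) (use g t in \<open>auto intro: is_idealD[OF ideal]\<close>)
  have "transv m x (\<lambda>i. s * z i + (s * t) * g i) \<in> N"
    using N_mult[OF 3 4] z by (simp add: transv_mult_same_left)
  then show "transv m x (\<lambda>i. (dotp m g u)\<^sup>2 * y i) \<in> N"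
    by (simp add: z_def s_def algebra_simps power2_eq_square)
qed

lemma minor_square_in_coeff_ideal:
  assumes jk: "j < m" "k < m" "j \<noteq> k"
  shows "(d j * x k - d k * x j)\<^sup>2 \<in> coeff_ideal x"
proof -
  \<comment> \<open>The third index exists because \<open>m\<close> is at least 3; the row
    \<open>g\<close> below needs three coordinates.\<close>
  obtain i where i: "i < m" "i \<noteq> j" "i \<noteq> k"
  proof -
    have "card {j, k} < card {..<m}" using m3 jk by simp
    then have "{..<m} - {j, k} \<noteq> {}"
      by (metis card_mono finite.emptyI finite_insert Diff_eq_empty_iff not_le)
    then show thesis using that by auto
  qed
  define \<delta> :: "nat \<Rightarrow> nat \<Rightarrow> 'a" where "\<delta> = (\<lambda>k i. if i = k then 1 else 0)"
  \<comment> \<open>the cross product of \<open>d\<close> and \<open>x\<close> in the coordinates \<open>i, j, k\<close>\<close>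
  define g where "g = (\<lambda>l. (d j * x k - d k * x j) * \<delta> i l + ((d k * x i - d i * x k) * \<delta> j l
    + (d i * x j - d j * x i) * \<delta> k l))"
  \<comment> \<open>The \<open>i\<close>-th unit vector is corrected by a multiple of
    \<open>d\<close> to lie in the kernel of \<open>c\<close>. As \<open>g d = 0\<close>, the
    correction does not change \<open>g u\<close>, which is the \<open>i\<close>-th entry of
    \<open>g\<close>, the desired minor.\<close>
  define u where "u = (\<lambda>l. \<delta> i l - c i * d l)"
  have \<delta>: "dotp m (\<delta> l) v = v l" "dotp m v (\<delta> l) = v l" if "l < m" for l v
    using that by (simp_all add: \<delta>_def)
  have gd: "dotp m g d = 0"
    using i jk unfolding g_def by (simp add: \<delta> algebra_simps)
  have gx: "dotp m g x = 0"
    using i jk unfolding g_def by (simp add: \<delta> algebra_simps)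
  have "dotp m g u = g i - c i * dotp m g d"
    using i unfolding u_def by (simp add: \<delta>)
  also have "\<dots> = d j * x k - d k * x j"
    using gd i by (simp add: g_def \<delta>_def)
  finally have "dotp m g u = d j * x k - d k * x j" .
  moreover have "dotp m c u = 0"
    using i cd unfolding u_def by (simp add: \<delta>)
  ultimately show ?thesis using square_in_coeff_ideal[OF gd gx] by metis
qed

text \<open>The new vector is the image of \<open>x\<close> under \<open>1 + u c\<close>.
  Conjugating by the inverse of this matrix brings transvections along the new vector back to
  transvections along \<open>x\<close>.\<close>

lemma coeff_ideal_translate:
  assumes u: "dotp m c u = 0"
  shows "coeff_ideal (\<lambda>i. x i + dotp m c x * u i) \<subseteq> coeff_ideal x"
proof
  fix l assume l: "l \<in> coeff_ideal (\<lambda>i. x i + dotp m c x * u i)"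
  show "l \<in> coeff_ideal x"
  proof (rule coeff_idealI)
    fix y assume y: "dotp m y x = 0" "\<And>i. i < m \<Longrightarrow> y i \<in> I"
    define b where "b = dotp m y u"
    have b: "b \<in> I"
      unfolding b_def dotp_def by (intro is_ideal_sum[OF ideal] is_idealD(5)[OF ideal]) (simp add: y)
    define x' where "x' = (\<lambda>i. x i + dotp m c x * u i)"
    \<comment> \<open>\<open>y'\<close> is \<open>y\<close> times the inverse of
      \<open>1 + u c\<close>, so \<open>y' x' = y x = 0\<close>, and its entries stay in
      \<open>I\<close>.\<close>
    define y' where "y' = (\<lambda>i. y i - b * c i)"
    have N: "transv m x' (\<lambda>i. l * y' i) \<in> N"
      unfolding x'_def by (intro coeff_idealD[OF l])
        (use y u b in \<open>auto simp: y'_def b_def intro!: is_idealD(5,6)[OF ideal]\<close>)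
    have "transv m (\<lambda>i. - u i) c * transv m x' (\<lambda>i. l * y' i) * transv m (\<lambda>i. - (- u i)) c \<in> N"
      by (intro N_conj G_c N) (use u in simp_all)
    also have "transv m (\<lambda>i. - u i) c * transv m x' (\<lambda>i. l * y' i) * transv m (\<lambda>i. - (- u i)) c
       = transv m (\<lambda>i. x' i + dotp m c x' * - u i)
           (\<lambda>i. l * y' i - dotp m (\<lambda>i. l * y' i) (\<lambda>i. - u i) * c i)"
      by (rule transv_conj) (use u in simp)
    also have "\<dots> = transv m x (\<lambda>i. l * y i)"
    proof -
      have eqs: "dotp m c x' = dotp m c x" "dotp m (\<lambda>i. l * y' i) (\<lambda>i. - u i) = - (l * b)"
        using u by (simp_all add: x'_def y'_def b_def)
      show ?thesis
        unfolding eqs by (intro transv_cong) (simp add: x'_def y'_def algebra_simps)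
    qed
    finally show "transv m x (\<lambda>i. l * y i) \<in> N" .
  qed
qed

text \<open>Only squares of minors are known to lie in the ideal, so linear combinations of minors
  are formed in its radical. Nothing is lost at the end, since every power of 1 is 1.\<close>

lemma one_in_coeff_ideal:
  assumes x: "dotp m z x = 1"
  shows "1 \<in> coeff_ideal x"
proof -
  define rad where "rad = {r. \<exists>n. r ^ n \<in> coeff_ideal x}"
  have rad: "is_ideal rad"
    unfolding rad_def by (rule is_ideal_radical[OF is_ideal_coeff_ideal])
  define a where "a = dotp m c x"
  have minor: "d j * x k - d k * x j \<in> rad" if "j < m" "k < m" for j k
    using minor_square_in_coeff_ideal[of j k x] that is_idealD(1)[OF rad]
    by (cases "j = k") (auto simp: rad_def)
  have ad: "a * d j \<in> rad" if j: "j < m" for j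
  proof -
    obtain k where k: "k < m" "k \<noteq> j"
      using m3 that by (metis less_le_trans numeral_3_eq_3 zero_less_Suc Suc_less_eq n_not_Suc_n)
    \<comment> \<open>For this \<open>u\<close> in the kernel of \<open>c\<close> one has
      \<open>d j * u k - d k * u j = d j\<close>. Translating \<open>x\<close> by \<open>a u\<close>
      thus changes the minor by exactly \<open>a * d j\<close>.\<close>
    define u where "u = (\<lambda>i. (if i = k then 1 else 0) - c k * d i)"
    have u: "dotp m c u = 0" using k cd by (simp add: u_def)
    have "(d j * (x k + a * u k) - d k * (x j + a * u j))\<^sup>2 \<in> coeff_ideal x"
      using minor_square_in_coeff_ideal[of j k "\<lambda>i. x i + a * u i"] coeff_ideal_translate[OF u, of x]
        j k by (auto simp: a_def)
    then have "d j * (x k + a * u k) - d k * (x j + a * u j) \<in> rad"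
      unfolding rad_def by blast
    also have "d j * (x k + a * u k) - d k * (x j + a * u j) = (d j * x k - d k * x j) + a * d j"
      using k by (simp add: u_def algebra_simps)
    finally have "(d j * x k - d k * x j) + a * d j - (d j * x k - d k * x j) \<in> rad"
      by (rule is_idealD(6)[OF rad]) (rule minor[OF j k(1)])
    then show ?thesis by simp
  qed
  have "x k \<in> rad" if k: "k < m" for k
  proof -
    \<comment> \<open>Summing the minors against \<open>c\<close> and using \<open>c d = 1\<close>
      recovers \<open>x k\<close> up to a multiple of \<open>a\<close>.\<close>
    have "x k = (\<Sum>j<m. c j * (d j * x k - d k * x j)) + d k * a"
    proof -
      have "(\<Sum>j<m. c j * (d j * x k - d k * x j)) = dotp m c d * x k - d k * dotp m c x"
        by (simp add: dotp_def algebra_simps sum_subtractf sum_distrib_left)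
      then show ?thesis by (simp add: cd a_def)
    qed
    moreover have "(\<Sum>j<m. c j * (d j * x k - d k * x j)) \<in> rad"
      by (intro is_ideal_sum[OF rad] is_idealD(4)[OF rad] minor k) simp
    moreover have "d k * a \<in> rad" using ad[OF k] by (simp add: mult.commute)
    ultimately show ?thesis using is_idealD(2)[OF rad] by metis
  qed
  then have "dotp m z x \<in> rad"
    unfolding dotp_def by (intro is_ideal_sum[OF rad] is_idealD(4)[OF rad]) simp
  then show ?thesis by (simp add: x rad_def)
qed

theorem transv_unimodular_left:
  assumes "dotp m z x = 1" "dotp m y x = 0" "\<And>i. i < m \<Longrightarrow> y i \<in> I"
  shows "transv m x y \<in> N"
  using coeff_idealD[OF one_in_coeff_ideal[OF assms(1)] assms(2,3)] by simp

theorem transv_unimodular_right: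
  assumes "dotp m z y = 1" "dotp m y x = 0" "\<And>i. i < m \<Longrightarrow> x i \<in> I"
  shows "transv m x y \<in> N"
proof -
  have "transv m y x \<in> transpose_mat ` N"
    by (rule transvection_pair.transv_unimodular_left[OF dual])
       (use assms in \<open>auto simp: dotp_comm\<close>)
  then show ?thesis
    by (metis (no_types, lifting) image_iff transpose_transpose transv_transpose)
qed

end

section \<open>Generated groups and normal closures\<close>

lemma gen_group_carrier:
  assumes "S \<subseteq> carrier_mat m m"
  shows "gen_group m S \<subseteq> carrier_mat m m"
proof
  show "a \<in> carrier_mat m m" if "a \<in> gen_group m S" for a
    using that by induction (use assms in auto)
qed

lemma gen_group_least:
  assumes "S \<subseteq> gen_group m T"
  shows "gen_group m S \<subseteq> gen_group m T"
proof
  show "a \<in> gen_group m T" if "a \<in> gen_group m S" for a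
    using that by induction (use assms in \<open>auto intro: gen_group.intros\<close>)
qed

text \<open>Conjugation by \<open>g\<close> is multiplicative and sends a generator
  \<open>k h k'\<close> to \<open>(g k) h (k' g')\<close>, again a generator. Induction over the
  generated group does the rest.\<close>

lemma normal_closure_conj:
  assumes G: "G \<subseteq> carrier_mat m m" "\<And>a b. a \<in> G \<Longrightarrow> b \<in> G \<Longrightarrow> a * b \<in> G"
    and S: "S \<subseteq> carrier_mat m m"
    and g: "g \<in> G" "g' \<in> carrier_mat m m" "g * g' = 1\<^sub>m m" "g' * g = 1\<^sub>m m"
    and a: "a \<in> normal_closure m G S"
  shows "g * a * g' \<in> normal_closure m G S"
proof -
  define T where "T = {g * h * g' | g h g'. g \<in> G \<and> h \<in> gen_group m S
      \<and> g' \<in> carrier_mat m m \<and> g * g' = 1\<^sub>m m \<and> g' * g = 1\<^sub>m m}"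
  note [simp] = assoc_mult_mat[of _ m m _ m _ m]
  note gc = subsetD[OF G(1) g(1)] g(2)
  have conj_mult: "g * a * g' * (g * b * g') = g * (a * b) * g'"
    if "a \<in> carrier_mat m m" "b \<in> carrier_mat m m" for a b
  proof -
    have "g * a * g' * (g * b * g') = g * (a * ((g' * g) * (b * g')))"
      using that gc by simp
    also have "\<dots> = g * (a * b) * g'"
      unfolding g(4) using that gc by simp
    finally show ?thesis .
  qed
  have Tc: "T \<subseteq> carrier_mat m m"
    using G(1) gen_group_carrier[OF S] by (auto simp: T_def intro!: mult_carrier_mat)
  note c = subsetD[OF gen_group_carrier[OF Tc]]
  have "a \<in> gen_group m T"
    using a by (simp add: normal_closure_def T_def)
  then have "g * a * g' \<in> gen_group m T"
  proof induction
    case gen_one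
    then show ?case using gc g by (auto intro: gen_group.gen_one)
  next
    case (gen_base t)
    then obtain k h k' where t: "t = k * h * k'" "k \<in> G" "h \<in> gen_group m S"
        "k' \<in> carrier_mat m m" "k * k' = 1\<^sub>m m" "k' * k = 1\<^sub>m m"
      by (auto simp: T_def)
    note tc = subsetD[OF G(1) t(2)] subsetD[OF gen_group_carrier[OF S] t(3)] t(4)
    have "(g * k) * (k' * g') = g * ((k * k') * g')" "(k' * g') * (g * k) = k' * ((g' * g) * k)"
      using tc gc by simp_all
    then have "(g * k) * (k' * g') = 1\<^sub>m m" "(k' * g') * (g * k) = 1\<^sub>m m"
      unfolding t g using tc gc t g by simp_all
    moreover have "g * t * g' = (g * k) * h * (k' * g')"
      using tc gc t by simp
    ultimately have "g * t * g' \<in> T"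
      unfolding T_def using t g(1) G(2) gc tc
      by (intro CollectI exI[of _ "g * k"] exI[of _ h] exI[of _ "k' * g'"] conjI) auto
    then show ?case by (rule gen_group.gen_base)
  next
    case (gen_mult a b)
    then show ?case
      using conj_mult[of a b] c gen_group.gen_mult by metis
  next
    case (gen_inv a b)
    have ac: "a \<in> carrier_mat m m" using gen_inv c by blast
    show ?case
    proof (rule gen_group.gen_inv[OF gen_inv.IH])
      show "g * b * g' \<in> carrier_mat m m" using gc gen_inv by auto
      show "g * a * g' * (g * b * g') = 1\<^sub>m m" "g * b * g' * (g * a * g') = 1\<^sub>m m"
        unfolding conj_mult[OF ac gen_inv(2)] conj_mult[OF gen_inv(2) ac]
        using gc g gen_inv by simp_all
    qed
  qed
  then show ?thesis by (simp add: normal_closure_def T_def)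
qed

lemma gen_group_subset_normal_closure:
  assumes "1\<^sub>m m \<in> G" "S \<subseteq> carrier_mat m m"
  shows "gen_group m S \<subseteq> normal_closure m G S"
proof
  fix h assume h: "h \<in> gen_group m S"
  then have "h = 1\<^sub>m m * h * 1\<^sub>m m"
    using gen_group_carrier[OF assms(2)] by auto
  with h assms(1) show "h \<in> normal_closure m G S"
    unfolding normal_closure_def
    by (intro gen_group.gen_base CollectI exI[of _ "1\<^sub>m m"] exI[of _ h]) auto
qed

lemma normal_closure_least:
  assumes G: "G \<subseteq> carrier_mat m m" "\<And>a b. a \<in> G \<Longrightarrow> b \<in> G \<Longrightarrow> a * b \<in> G"
    and T: "T \<subseteq> carrier_mat m m"
    and "F \<subseteq> G" "S \<subseteq> normal_closure m G T"
  shows "normal_closure m F S \<subseteq> normal_closure m G T"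
proof -
  have "gen_group m S \<subseteq> normal_closure m G T"
    using assms(5) unfolding normal_closure_def by (rule gen_group_least)
  then have "{g * h * g' | g h g'. g \<in> F \<and> h \<in> gen_group m S
      \<and> g' \<in> carrier_mat m m \<and> g * g' = 1\<^sub>m m \<and> g' * g = 1\<^sub>m m} \<subseteq> normal_closure m G T"
    using assms(4) by (auto intro!: normal_closure_conj[OF G T])
  then show ?thesis
    unfolding normal_closure_def by (rule gen_group_least)
qed

text \<open>The closure axioms of the locale hold for any generated group and normal closure, so a
  concrete pair only has to supply its transvections with column \<open>d\<close> or row
  \<open>c\<close>.\<close>

lemma transvection_pair_normal_closure:
  assumes "is_ideal I" "m \<ge> 3" "dotp m c d = 1"
    and S: "S \<subseteq> carrier_mat m m" and T: "T \<subseteq> carrier_mat m m"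
    and "\<And>w. dotp m w d = 0 \<Longrightarrow> transv m d w \<in> gen_group m S"
    and "\<And>u. dotp m c u = 0 \<Longrightarrow> transv m u c \<in> gen_group m S"
    and "\<And>w. dotp m w d = 0 \<Longrightarrow> (\<And>i. i < m \<Longrightarrow> w i \<in> I) \<Longrightarrow> transv m d w \<in> gen_group m T"
    and "\<And>u. dotp m c u = 0 \<Longrightarrow> (\<And>i. i < m \<Longrightarrow> u i \<in> I) \<Longrightarrow> transv m u c \<in> gen_group m T"
  shows "transvection_pair m I c d (gen_group m S) (normal_closure m (gen_group m S) T)"
proof -
  note G = gen_group_carrier[OF S]
  note TN = subsetD[OF gen_group_subset_normal_closure[OF gen_group.gen_one[of m S] T]]
  show ?thesis
  proof (unfold_locales, goal_cases)
    case (6 x g)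
    then show ?case by (intro gen_group.gen_inv[OF 6(1)] transv_inverse) auto
  next
    case 9
    show ?case
      unfolding normal_closure_def
      by (rule gen_group_carrier) (use G gen_group_carrier[OF T] in \<open>auto intro!: mult_carrier_mat\<close>)
  next
    case (10 A B)
    then show ?case by (auto simp: normal_closure_def intro: gen_group.gen_mult)
  next
    case (11 x g A)
    then show ?case
      by (intro normal_closure_conj[OF G gen_group.gen_mult T] transv_inverse) auto
  qed (use assms G TN in \<open>auto intro: gen_group.gen_mult\<close>)
qed

section \<open>The elementary group as a transvection pair\<close>

lemma elem_mat_eq_transv:
  "elem_mat m i j l = transv m (\<lambda>a. if a = i then 1 else 0) (\<lambda>b. if b = j then l else 0)"
  "elem_mat m i j l = transv m (\<lambda>a. if a = i then l else 0) (\<lambda>b. if b = j then 1 else 0)"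
  by (auto simp: elem_mat_def transv_def)

lemma E_gens_carrier: "E_gens m I \<subseteq> carrier_mat m m"
  by (auto simp: E_gens_def elem_mat_eq_transv)

lemma transv_first_in_gen_group:
  fixes w :: "nat \<Rightarrow> 'a::comm_ring_1"
  assumes m: "0 < m" and w: "w 0 = 0" "\<And>i. i < m \<Longrightarrow> w i \<in> I"
  defines "e \<equiv> \<lambda>i. if i = 0 then 1 else 0 :: 'a"
  shows "transv m e w \<in> gen_group m (E_gens m I)" "transv m w e \<in> gen_group m (E_gens m I)"
proof -
  \<comment> \<open>Truncating \<open>w\<close> after \<open>k\<close> entries builds the
    transvection as a product of elementary matrices, one per entry. The entry at index 0
    contributes the identity, because \<open>w 0 = 0\<close>.\<close>
  define v where "v = (\<lambda>k i. if i < k then w i else 0)"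
  have v0: "dotp m (v k) e = 0" "dotp m e (v k) = 0" for k
    using m w by (simp_all add: e_def v_def)
  have *: "transv m e (v k) \<in> gen_group m (E_gens m I)
      \<and> transv m (v k) e \<in> gen_group m (E_gens m I)" if "k \<le> m" for k
    using that
  proof (induction k)
    case 0
    then show ?case by (simp add: v_def gen_group.gen_one)
  next
    case (Suc k)
    let ?f = "\<lambda>i. if i = k then w k else 0"
    have Sk: "v (Suc k) = (\<lambda>i. v k i + ?f i)"
      by (auto simp: v_def fun_eq_iff)
    have ef: "dotp m e ?f = 0"
      using Suc w by (cases "k = 0") (simp_all add: e_def)
    have f: "transv m e ?f \<in> gen_group m (E_gens m I)" "transv m ?f e \<in> gen_group m (E_gens m I)"
    proof -
      have "transv m e ?f \<in> gen_group m (E_gens m I) \<and> transv m ?f e \<in> gen_group m (E_gens m I)"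
      proof (cases "k = 0")
        case True
        with w have "?f = (\<lambda>i. 0)" by auto
        then show ?thesis by (simp add: gen_group.gen_one)
      next
        case False
        then have "elem_mat m 0 k (w k) \<in> E_gens m I" "elem_mat m k 0 (w k) \<in> E_gens m I"
          using Suc w m unfolding E_gens_def by force+
        moreover have "transv m e ?f = elem_mat m 0 k (w k)" "transv m ?f e = elem_mat m k 0 (w k)"
          unfolding e_def by (rule elem_mat_eq_transv[symmetric])+
        ultimately show ?thesis by (auto intro: gen_group.gen_base)
      qed
      then show "transv m e ?f \<in> gen_group m (E_gens m I)" "transv m ?f e \<in> gen_group m (E_gens m I)"
        by auto
    qed
    have "transv m e (v (Suc k)) = transv m e (v k) * transv m e ?f"
      unfolding Sk by (rule transv_mult_same_left[symmetric]) (rule v0)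
    moreover have "transv m (v (Suc k)) e = transv m (v k) e * transv m ?f e"
      unfolding Sk by (rule transv_mult_same_right[symmetric]) (rule ef)
    ultimately show ?case
      using Suc f by (auto intro: gen_group.gen_mult)
  qed
  have "transv m e w = transv m e (v m)" "transv m w e = transv m (v m) e"
    by (auto simp: v_def intro!: transv_cong)
  then show "transv m e w \<in> gen_group m (E_gens m I)" "transv m w e \<in> gen_group m (E_gens m I)"
    using *[of m] by auto
qed

lemma transvection_pair_elementary:
  assumes "is_ideal (I :: 'a::comm_ring_1 set)" "m \<ge> 3"
  defines "e \<equiv> \<lambda>i. if i = 0 then 1 else 0 :: 'a"
  shows "transvection_pair m I e e (gen_group m (E_gens m UNIV)) (E_rel m I)"
proof -
  have e: "dotp m w e = w 0" "dotp m e w = w 0" for w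
    using assms(2) by (simp_all add: e_def)
  note first = transv_first_in_gen_group[where 'a = 'a, of m, folded e_def]
  show ?thesis
    unfolding E_rel_def
    by (rule transvection_pair_normal_closure; (intro first)?)
       (use assms(1,2) in \<open>simp_all add: E_gens_carrier e\<close>, simp add: e_def)
qed

text \<open>An elementary matrix is a transvection whose column is a unit vector, which is
  unimodular; \<open>i\<close> and \<open>j\<close> being distinct makes the row annihilate
  it.\<close>

lemma E_gens_subset:
  assumes "transvection_pair m I c d G N"
  shows "E_gens m I \<subseteq> N"
proof
  fix A assume "A \<in> E_gens m I"
  then obtain i j l where A: "A = elem_mat m i j l" "i < m" "j < m" "i \<noteq> j" "l \<in> I"
    by (auto simp: E_gens_def)
  show "A \<in> N"
    unfolding A(1) elem_mat_eq_transv(1)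
    by (rule transvection_pair.transv_unimodular_left[OF assms,
          where z = "\<lambda>a. if a = i then 1 else 0"])
       (use A is_idealD(1)[OF transvection_pair.ideal[OF assms]] in auto)
qed

section \<open>Alternating matrices and their block relations\<close>

lemma mult_mat_index_Suc:
  assumes "A \<in> carrier_mat (Suc m) (Suc m)" "B \<in> carrier_mat (Suc m) (Suc m)"
    "i < Suc m" "j < Suc m"
  shows "(A * B) $$ (i, j) = A $$ (i, 0) * B $$ (0, j) + (\<Sum>k<m. A $$ (i, Suc k) * B $$ (Suc k, j))"
proof -
  have "(A * B) $$ (i, j) = (\<Sum>k<Suc m. A $$ (i, k) * B $$ (k, j))"
    using assms by (simp add: scalar_prod_def lessThan_atLeast0)
  then show ?thesis by (simp only: sum.lessThan_Suc_shift)
qed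

lemma alternating_mat_index:
  assumes "alternating_mat m A" "i < m"
  shows "j < m \<Longrightarrow> A $$ (j, i) = - A $$ (i, j)" "A $$ (i, i) = 0"
  using assms by (auto simp: alternating_mat_def)

text \<open>From \<open>A B = 1\<close> follows \<open>B = B^t A^t B\<close>, and substituting
  \<open>A = C - C^t\<close> writes \<open>B\<close> as \<open>D - D^t\<close> with
  \<open>D = B^t C^t B\<close>. Exhibiting \<open>D\<close> also gives the zero diagonal when 2 is a
  zero divisor.\<close>

lemma alternating_mat_inverse:
  fixes A B :: "'a::comm_ring_1 mat"
  assumes "alternating_mat m A" "B \<in> carrier_mat m m" "A * B = 1\<^sub>m m" "B * A = 1\<^sub>m m"
  shows "alternating_mat m B"
proof -
  obtain C where C: "C \<in> carrier_mat m m" "A = C - transpose_mat C" and A: "A \<in> carrier_mat m m"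
    using assms by (auto simp: alternating_mat_def)
  note B = assms(2)
  have tA: "transpose_mat A = transpose_mat C - C"
    using C by (auto simp: transpose_minus)
  have tBA: "transpose_mat B * transpose_mat A = 1\<^sub>m m"
    using transpose_mult[OF A B] assms(3) by simp
  have "B = (transpose_mat B * transpose_mat A) * B"
    using B by (simp add: tBA)
  also have "\<dots> = transpose_mat B * (transpose_mat C - C) * B"
    by (simp add: tA)
  also have "\<dots> = transpose_mat B * transpose_mat C * B - transpose_mat B * C * B"
    using B C by (simp add: mult_minus_distrib_mat[of _ m m] minus_mult_distrib_mat[of _ m m])
  also have "transpose_mat B * C * B = transpose_mat (transpose_mat B * transpose_mat C * B)"
    using B C transpose_mult[of "transpose_mat B * transpose_mat C" m m B m]
      transpose_mult[of "transpose_mat B" m m "transpose_mat C" m]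
    by (simp add: assoc_mult_mat[of _ m m _ m _ m])
  finally show ?thesis
    unfolding alternating_mat_def using B C
    by (intro conjI bexI[of _ "transpose_mat B * transpose_mat C * B"]) auto
qed

locale alternating_pair =
  fixes m :: nat and \<phi> \<psi> :: "'a::comm_ring_1 mat"
  assumes m3: "m \<ge> 3" and phi: "alternating_mat (Suc m) \<phi>"
    and psi: "\<psi> \<in> carrier_mat (Suc m) (Suc m)"
    and phi_psi: "\<phi> * \<psi> = 1\<^sub>m (Suc m)" and psi_phi: "\<psi> * \<phi> = 1\<^sub>m (Suc m)"
begin

definition c :: "nat \<Rightarrow> 'a" where "c j = - \<phi> $$ (0, Suc j)"
definition d :: "nat \<Rightarrow> 'a" where "d j = \<psi> $$ (0, Suc j)"
definition \<nu> :: "nat \<Rightarrow> nat \<Rightarrow> 'a" where "\<nu> i j = \<phi> $$ (Suc i, Suc j)"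
definition \<mu> :: "nat \<Rightarrow> nat \<Rightarrow> 'a" where "\<mu> i j = \<psi> $$ (Suc i, Suc j)"

lemma phi_carrier: "\<phi> \<in> carrier_mat (Suc m) (Suc m)"
  using phi by (simp add: alternating_mat_def)

text \<open>The first three are blocks of \<open>\<phi> * \<psi> = 1\<close>, the last is the lower
  right block of \<open>\<psi> * \<phi> = 1\<close>.\<close>

lemma block_relations:
  "dotp m c d = 1"
  "i < m \<Longrightarrow> dotp m (\<nu> i) d = 0"
  "j < m \<Longrightarrow> dotp m c (\<lambda>k. \<mu> k j) = 0"
  "i < m \<Longrightarrow> j < m \<Longrightarrow> (\<Sum>k<m. \<mu> i k * \<nu> k j) = (if i = j then 1 else 0) - d i * c j"
proof -
  note alt_phi = alternating_mat_index[OF phi]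
  note alt_psi = alternating_mat_index[OF alternating_mat_inverse[OF phi psi phi_psi psi_phi]]
  note idx = mult_mat_index_Suc[OF phi_carrier psi, unfolded phi_psi]
    and idx' = mult_mat_index_Suc[OF psi phi_carrier, unfolded psi_phi]
  have psi_col: "\<psi> $$ (Suc k, 0) = - d k" if "k < m" for k
    using alt_psi(1)[of 0 "Suc k"] that by (simp add: d_def)
  have psi_col_sum: "(\<Sum>k<m. f k * \<psi> $$ (Suc k, 0)) = - dotp m f d" for f
    by (simp add: dotp_def psi_col sum_negf)
  show "dotp m c d = 1"
    using idx[of 0 0] alt_phi(2)[of 0] by (simp add: psi_col_sum c_def[abs_def])
  show "i < m \<Longrightarrow> dotp m (\<nu> i) d = 0"
    using idx[of "Suc i" 0] alt_psi(2)[of 0] by (simp add: psi_col_sum \<nu>_def[abs_def])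
  show "j < m \<Longrightarrow> dotp m c (\<lambda>k. \<mu> k j) = 0"
    using idx[of 0 "Suc j"] alt_phi(2)[of 0] by (simp add: dotp_def c_def \<mu>_def sum_negf)
  show "i < m \<Longrightarrow> j < m \<Longrightarrow> (\<Sum>k<m. \<mu> i k * \<nu> k j) = (if i = j then 1 else 0) - d i * c j"
    using idx'[of "Suc i" "Suc j"]
    by (simp add: psi_col \<mu>_def \<nu>_def c_def algebra_simps split: if_splits)
qed

section \<open>The group of the alternating matrix as a transvection pair\<close>

lemma alpha_phi_eq_transv:
  assumes "v \<in> carrier_mat 1 m"
  shows "alpha_phi m \<phi> \<psi> v = transv m d (\<lambda>j. dotp m (\<lambda>k. v $$ (0, k)) (\<lambda>k. \<nu> k j))"
  using assms
  by (intro eq_matI)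
     (auto simp: alpha_phi_def transv_def psi_d_def phi_nu_def scalar_prod_def dotp_def
        d_def \<nu>_def lessThan_atLeast0 sum_distrib_left mult.assoc)

lemma beta_phi_eq_transv:
  assumes "v \<in> carrier_mat 1 m"
  shows "beta_phi m \<phi> \<psi> v = transv m (\<lambda>i. dotp m (\<mu> i) (\<lambda>k. v $$ (0, k))) c"
  using assms
  by (intro eq_matI)
     (auto simp: beta_phi_def transv_def psi_mu_def phi_c_def scalar_prod_def dotp_def
        c_def \<mu>_def lessThan_atLeast0)

text \<open>The relations \<open>\<nu> d = 0\<close> and \<open>c \<mu> = 0\<close> put the
  generators into the two kernels. Conversely \<open>\<mu> \<nu> = 1 - d c\<close> acts as the
  identity on rows annihilating \<open>d\<close> and on columns annihilated by \<open>c\<close>, so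
  every such transvection is a generator.\<close>

lemma Ephi_gens_eq:
  assumes I: "is_ideal I"
  shows "Ephi_gens m \<phi> \<psi> I = {transv m d w | w. dotp m w d = 0 \<and> (\<forall>i<m. w i \<in> I)}
     \<union> {transv m u c | u. dotp m c u = 0 \<and> (\<forall>i<m. u i \<in> I)}"
    (is "_ = ?D \<union> ?C")
proof -
  have dotpI: "dotp m f h \<in> I" "dotp m h f \<in> I" if "\<And>i. i < m \<Longrightarrow> f i \<in> I" for f h
    unfolding dotp_def
    by (intro is_ideal_sum[OF I] is_idealD(5)[OF I], simp add: that,
        intro is_ideal_sum[OF I] is_idealD(4)[OF I], simp add: that)
  have dotp_cong0: "dotp m f h = 0" if "\<And>i. i < m \<Longrightarrow> h i = 0" for f h
    using that by (simp add: dotp_def)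
  have "alpha_phi m \<phi> \<psi> v \<in> ?D" if "v \<in> carrier_mat 1 m" "\<forall>j<m. v $$ (0, j) \<in> I" for v
  proof -
    have "dotp m (\<lambda>j. dotp m (\<lambda>k. v $$ (0, k)) (\<lambda>k. \<nu> k j)) d = 0"
      unfolding dotp_dotp by (intro dotp_cong0 block_relations)
    then show ?thesis
      unfolding alpha_phi_eq_transv[OF that(1)] using that(2)
      by (intro CollectI exI[of _ "\<lambda>j. dotp m (\<lambda>k. v $$ (0, k)) (\<lambda>k. \<nu> k j)"] conjI)
         (auto intro!: dotpI(1))
  qed
  moreover have "beta_phi m \<phi> \<psi> v \<in> ?C" if "v \<in> carrier_mat 1 m" "\<forall>j<m. v $$ (0, j) \<in> I" for v
  proof -
    have "dotp m c (\<lambda>i. dotp m (\<mu> i) (\<lambda>k. v $$ (0, k)))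
        = dotp m (\<lambda>k. v $$ (0, k)) (\<lambda>j. dotp m c (\<lambda>k. \<mu> k j))"
      by (simp only: dotp_comm[of m "\<lambda>k. v $$ (0, k)"] dotp_dotp)
    also have "\<dots> = 0"
      by (intro dotp_cong0 block_relations)
    finally show ?thesis
      unfolding beta_phi_eq_transv[OF that(1)] using that(2)
      by (intro CollectI exI[of _ "\<lambda>i. dotp m (\<mu> i) (\<lambda>k. v $$ (0, k))"] conjI)
         (auto intro!: dotpI(2))
  qed
  moreover have "transv m d w \<in> {alpha_phi m \<phi> \<psi> v | v. v \<in> carrier_mat 1 m \<and> (\<forall>j<m. v $$ (0,j) \<in> I)}"
    if w: "dotp m w d = 0" "\<forall>i<m. w i \<in> I" for w
  proof -
    \<comment> \<open>The row \<open>v = w \<mu>\<close> works since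
      \<open>w \<mu> \<nu> = w - (w d) c = w\<close>.\<close>
    define v where "v = mat 1 m (\<lambda>(_, k). dotp m w (\<lambda>i. \<mu> i k))"
    have v: "v \<in> carrier_mat 1 m" "\<forall>j<m. v $$ (0, j) \<in> I"
      using w by (auto simp: v_def intro!: dotpI(1))
    have "dotp m (\<lambda>k. v $$ (0, k)) (\<lambda>k. \<nu> k j) = w j" if j: "j < m" for j
    proof -
      have "dotp m (\<lambda>k. v $$ (0, k)) (\<lambda>k. \<nu> k j) = dotp m (\<lambda>k. dotp m w (\<lambda>i. \<mu> i k)) (\<lambda>k. \<nu> k j)"
        by (simp add: dotp_def v_def)
      also have "\<dots> = dotp m w (\<lambda>i. dotp m (\<mu> i) (\<lambda>k. \<nu> k j))"
        by (rule dotp_dotp)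
      also have "\<dots> = dotp m w (\<lambda>i. (if i = j then 1 else 0) - c j * d i)"
        using block_relations(4)[OF _ j] by (simp add: dotp_def mult.commute del: dotp_linear)
      also have "\<dots> = w j"
        using w j by simp
      finally show ?thesis .
    qed
    then have "transv m d w = alpha_phi m \<phi> \<psi> v"
      unfolding alpha_phi_eq_transv[OF v(1)] by (intro transv_cong) simp
    with v show ?thesis by blast
  qed
  moreover have "transv m u c \<in> {beta_phi m \<phi> \<psi> v | v. v \<in> carrier_mat 1 m \<and> (\<forall>j<m. v $$ (0,j) \<in> I)}"
    if u: "dotp m c u = 0" "\<forall>i<m. u i \<in> I" for u
  proof -
    \<comment> \<open>Dually, \<open>v\<close> is the transpose of \<open>\<nu> u\<close>, and
      \<open>\<mu> \<nu> u = u - d (c u) = u\<close>.\<close>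
    define v where "v = mat 1 m (\<lambda>(_, k). dotp m (\<nu> k) u)"
    have v: "v \<in> carrier_mat 1 m" "\<forall>j<m. v $$ (0, j) \<in> I"
      using u by (auto simp: v_def intro!: dotpI(2))
    have "dotp m (\<mu> i) (\<lambda>k. v $$ (0, k)) = u i" if i: "i < m" for i
    proof -
      have "dotp m (\<mu> i) (\<lambda>k. v $$ (0, k)) = dotp m (\<mu> i) (\<lambda>k. dotp m (\<nu> k) u)"
        by (simp add: dotp_def v_def)
      also have "\<dots> = dotp m (\<lambda>j. dotp m (\<mu> i) (\<lambda>k. \<nu> k j)) u"
        by (rule dotp_dotp[symmetric])
      also have "\<dots> = dotp m (\<lambda>j. (if j = i then 1 else 0) - d i * c j) u"
        using block_relations(4)[OF i] by (simp add: dotp_def eq_commute[of i] del: dotp_linear)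
      also have "\<dots> = u i"
        using u i by simp
      finally show ?thesis .
    qed
    then have "transv m u c = beta_phi m \<phi> \<psi> v"
      unfolding beta_phi_eq_transv[OF v(1)] by (intro transv_cong) simp
    with v show ?thesis by blast
  qed
  ultimately show ?thesis
    unfolding Ephi_gens_def by (intro equalityI subsetI; elim UnE CollectE exE conjE) blast+
qed

lemma Ephi_gens_carrier:
  assumes "is_ideal I"
  shows "Ephi_gens m \<phi> \<psi> I \<subseteq> carrier_mat m m"
  by (auto simp: Ephi_gens_eq[OF assms])

lemma transvection_pair_phi:
  assumes "is_ideal I"
  shows "transvection_pair m I c d (gen_group m (Ephi_gens m \<phi> \<psi> UNIV)) (Ephi_rel m \<phi> \<psi> I)"
  unfolding Ephi_rel_def
  by (rule transvection_pair_normal_closure[OF assms m3 block_relations(1)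
        Ephi_gens_carrier[OF is_ideal_UNIV] Ephi_gens_carrier[OF assms]])
     (auto simp: Ephi_gens_eq[OF is_ideal_UNIV] Ephi_gens_eq[OF assms] intro!: gen_group.gen_base)

text \<open>Since \<open>c d = 1\<close>, both the column \<open>d\<close> and the row
  \<open>c\<close> are unimodular, so one kind of generator falls under the left theorem and the
  other under the right one.\<close>

lemma Ephi_gens_subset:
  assumes "transvection_pair m I c' d' G N"
  shows "Ephi_gens m \<phi> \<psi> I \<subseteq> N"
  unfolding Ephi_gens_eq[OF transvection_pair.ideal[OF assms]]
  using transvection_pair.transv_unimodular_left[OF assms block_relations(1)]
    transvection_pair.transv_unimodular_right[OF assms, of d c] block_relations(1)
  by (auto simp: dotp_comm[of m d])

text \<open>Each pair absorbs the generators of the other. The absolute instances compare the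
  ambient groups and the relative ones the generators over \<open>I\<close>; together they give both
  inclusions of normal closures.\<close>

theorem E_rel_eq_Ephi_rel:
  assumes I: "is_ideal I"
  shows "E_rel m I = Ephi_rel m \<phi> \<psi> I"
proof -
  note elem = transvection_pair_elementary[OF I m3] and phi = transvection_pair_phi[OF I]
  have "E_gens m UNIV \<subseteq> gen_group m (Ephi_gens m \<phi> \<psi> UNIV)"
    by (rule E_gens_subset[OF transvection_pair.absolute[OF phi]])
  then have 1: "gen_group m (E_gens m UNIV) \<subseteq> gen_group m (Ephi_gens m \<phi> \<psi> UNIV)"
    by (rule gen_group_least)
  have "Ephi_gens m \<phi> \<psi> UNIV \<subseteq> gen_group m (E_gens m UNIV)"
    by (rule Ephi_gens_subset[OF transvection_pair.absolute[OF elem]])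
  then have 2: "gen_group m (Ephi_gens m \<phi> \<psi> UNIV) \<subseteq> gen_group m (E_gens m UNIV)"
    by (rule gen_group_least)
  show ?thesis
  proof
    show "E_rel m I \<subseteq> Ephi_rel m \<phi> \<psi> I"
      unfolding E_rel_def Ephi_rel_def
      by (rule normal_closure_least[OF gen_group_carrier gen_group.gen_mult])
         (use 1 E_gens_subset[OF phi] in
           \<open>simp_all add: Ephi_rel_def Ephi_gens_carrier I is_ideal_UNIV\<close>)
    show "Ephi_rel m \<phi> \<psi> I \<subseteq> E_rel m I"
      unfolding E_rel_def Ephi_rel_def
      by (rule normal_closure_least[OF gen_group_carrier gen_group.gen_mult])
         (use 2 Ephi_gens_subset[OF elem] in \<open>simp_all add: E_rel_def E_gens_carrier\<close>)
  qed
qed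

end

theorem theorem5p2:
  fixes \<phi> \<psi> :: "'a::comm_ring_1 mat" and I :: "'a set" and n :: nat
  assumes "is_ideal I"
    and "n \<ge> 2"
    and "alternating_mat (2*n) \<phi>"
    and "pfaffian n \<phi> = 1"
    and "\<psi> \<in> carrier_mat (2*n) (2*n)" and "\<phi> * \<psi> = 1\<^sub>m (2*n)" and "\<psi> * \<phi> = 1\<^sub>m (2*n)"
  shows "E_rel (2*n-1) I = Ephi_rel (2*n-1) \<phi> \<psi> I"
proof -
  \<comment> \<open>For \<open>n\<close> at least 2 the natural subtraction is exact, and
    \<open>2*n-1\<close> is at least 3 as the locale requires.\<close>
  have "Suc (2*n-1) = 2*n" using assms(2) by simp
  then interpret alternating_pair "2*n-1" \<phi> \<psi>
    by unfold_locales (use assms in auto)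
  show ?thesis by (rule E_rel_eq_Ephi_rel[OF assms(1)])
qed

end
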